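(* Let $N\ge 2$, $a\ge0$, $b>0$, $\alpha:=a+b-1$, $\beta:=b-1$, and let $z_{1,N}<\dots<z_{N,N}$ be the zeros of the Jacobi polynomial $P_N^{(\alpha,\beta)}$. Let $S_N=(s_{i,j})_{i,j=1,\dots,N}$ be the matrix with $$s_{j,j}=\sum_{l\ne j}\frac{1}{(z_{j,N}-z_{l,N})^2}+\frac{a+b}{2}\frac1{(1-z_{j,N})^2}+\frac b2\frac1{(1+z_{j,N})^2},\qquad s_{i,j}=\frac{-1}{(z_{i,N}-z_{j,N})^2}\ \ (i\ne j),$$ and let $\Sigma_N=(\sigma^N_{i,j})_{i,j=1,\dots,N}=S_N^{-1}$. Then, for all $i,j=1,\dots,N$, $$\sigma^N_{i,j}=\frac{(-1)^{i+j}\,4\sqrt{1-z_{i,N}^2}\sqrt{1-z_{j,N}^2}}{\sqrt{\sum_{k,l=0}^{N-1}\bigl(\tilde P_k^{(\alpha,\beta)}(z_{i,N})\tilde P_l^{(\alpha,\beta)}(z_{j,N})\bigr)^2}}\sum_{k=0}^{N-1}\frac{\tilde P_k^{(\alpha,\beta)}(z_{i,N})\tilde P_k^{(\alpha,\beta)}(z_{j,N})}{\lambda_{N-k}},$$ where $\lambda_k=2k(2N+\alpha+\beta+1-k)$ for $k=1,\dots,N$.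
   Context: $\tilde P_k^{(\alpha,\beta)}$ denotes the Jacobi polynomial of degree $k$ normalized to be orthonormal (with positive leading coefficient) with respect to the probability measure proportional to $(1-x)^\alpha(1+x)^\beta dx$ on $]-1,1[$. The matrix $\Sigma_N$ is the covariance matrix of the Gaussian limit $N(0,\Sigma_N)$, as $\kappa\to\infty$, of $\sqrt\kappa(X_\kappa-z)$, where $z=(z_{1,N},\dots,z_{N,N})$ and $X_\kappa$ has, with $(k_1,k_2,k_3)=\kappa(a,b,1)$, density proportional to $\prod_{i<j}(x_j-x_i)^{k_3}\prod_{i=1}^N(1-x_i)^{\frac{k_1+k_2}2-\frac12}(1+x_i)^{\frac{k_2}2-\frac12}$ on $\{-1\le x_1\le\dots\le x_N\le1\}$ (it is known that $S_N$ is its inverse). *)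

theory Defs
  imports
    "HOL-Analysis.Analysis"
    "HOL-Computational_Algebra.Polynomial"
    "Jordan_Normal_Form.Gauss_Jordan_Elimination"
begin

(* The classical Jacobi polynomial P_n^(\<alpha>,\<beta>) in Szegoe's normalization (4.21.2):
     P_n(x) = 1/n! * (\<Sum>k=0..n. (n choose k) * (n+\<alpha>+\<beta>+1)...(n+\<alpha>+\<beta>+k)
                               * (\<alpha>+k+1)...(\<alpha>+n) * ((x-1)/2)^k).
   For \<alpha>, \<beta> > -1 these are orthogonal with respect to (1-x)^\<alpha> (1+x)^\<beta> dx on ]-1,1[, and the
   leading coefficient pochhammer (n+\<alpha>+\<beta>+1) n / (2^n n!) is positive. *)
definition jacobi_poly :: "nat \<Rightarrow> real \<Rightarrow> real \<Rightarrow> real poly" where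
  "jacobi_poly n \<alpha> \<beta> =
     (\<Sum>k\<le>n. Polynomial.smult (real (n choose k) * pochhammer (real n + \<alpha> + \<beta> + 1) k
                      * pochhammer (\<alpha> + real k + 1) (n - k) / fact n)
                   ([:-1/2, 1/2:] ^ k))"

definition jacobi_weight :: "real \<Rightarrow> real \<Rightarrow> real \<Rightarrow> real" where
  "jacobi_weight \<alpha> \<beta> x = (1 - x) powr \<alpha> * (1 + x) powr \<beta>"

(* The probability measure on ]-1,1[ proportional to the Jacobi weight. *)
definition jacobi_measure :: "real \<Rightarrow> real \<Rightarrow> real measure" where
  "jacobi_measure \<alpha> \<beta> =
     density lborel (\<lambda>x. ennreal (indicator {-1<..<1} x * jacobi_weight \<alpha> \<beta> x
                          / (LBINT y:{-1<..<1}. jacobi_weight \<alpha> \<beta> y)))"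

(* The Jacobi polynomial of degree k scaled by a positive constant to unit norm in
   L^2(jacobi_measure), i.e. the orthonormal polynomial with positive leading coefficient. *)
definition jacobi_orthonormal :: "nat \<Rightarrow> real \<Rightarrow> real \<Rightarrow> real poly" where
  "jacobi_orthonormal k \<alpha> \<beta> =
     Polynomial.smult (1 / sqrt (LINT x|jacobi_measure \<alpha> \<beta>. (poly (jacobi_poly k \<alpha> \<beta>) x)\<^sup>2))
           (jacobi_poly k \<alpha> \<beta>)"

(* Matrix indices run over 0,...,N-1, and z i is the zero z_(i+1,N) of P_N. *)
definition S_mat :: "nat \<Rightarrow> real \<Rightarrow> real \<Rightarrow> (nat \<Rightarrow> real) \<Rightarrow> real mat" where
  "S_mat N a b z = Matrix.mat N N (\<lambda>(i, j).
     if i = j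
     then (\<Sum>l\<in>{..<N} - {j}. 1 / (z j - z l)\<^sup>2)
          + (a + b) / 2 * (1 / (1 - z j)\<^sup>2) + b / 2 * (1 / (1 + z j)\<^sup>2)
     else - 1 / (z i - z j)\<^sup>2)"

definition jacobi_lambda :: "nat \<Rightarrow> real \<Rightarrow> real \<Rightarrow> nat \<Rightarrow> real" where
  "jacobi_lambda N \<alpha> \<beta> k = 2 * real k * (2 * real N + \<alpha> + \<beta> + 1 - real k)"

end

theory Submission
  imports Defs "Jordan_Normal_Form.Determinant"
begin

text \<open>Write $p$ for the monic multiple of $P_N$. For $f$ of degree less than $N$ the numbers
  $v_l = f(z_l)/p'(z_l)$ are the residues of $f/p$, so $\sum_{l \ne j} v_l/(z_j-z_l)^2$ is read off the
  Laurent expansion of $f/p$ at $z_j$. For $f = P_k$ the Jacobi differential equations of $P_k$ and $P_N$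
  turn this into $(S_N v)_j = \frac{\lambda_{N-k}}{4}\, v_j/(1-z_j^2)$.

  On the other hand Gauss quadrature gives
  $\sum_{k<N} \tilde P_k(z_i) \tilde P_k(z_j) = \delta_{ij}/w_i$, where the weights satisfy
  $(1-z_i^2)\, p'(z_i)^2\, w_i = C$ for a constant $C$. Hence the matrix with entries
  $\frac{4C}{p'(z_i)p'(z_j)} \sum_k \tilde P_k(z_i)\tilde P_k(z_j)/\lambda_{N-k}$ is inverse to $S_N$, and
  the denominator in the claimed formula is
  $\sqrt{1-z_i^2}\sqrt{1-z_j^2}\,|p'(z_i)p'(z_j)|/C$, where $p'(z_i)$ has the sign $(-1)^{N-i}$
  (for $i$ counted from $1$).

  The only facts about the measure that enter are positivity and the Pearson equation
  $\int (q f' + r f)\, d\mu = 0$ for $q = 1-x^2$ and $r = \beta - \alpha - (\alpha+\beta+2)x$.\<close>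

section \<open>The Jacobi differential equation\<close>

abbreviation jacobi_q :: "real poly" where
  "jacobi_q \<equiv> [:1, 0, -1:]"

abbreviation jacobi_r :: "real \<Rightarrow> real \<Rightarrow> real poly" where
  "jacobi_r \<alpha> \<beta> \<equiv> [:\<beta> - \<alpha>, - (\<alpha> + \<beta> + 2):]"

text \<open>These are the coefficients in powers of t = (x - 1) / 2, the variable in which the
  differential equation becomes a two-term recurrence.\<close>

definition jacobi_coeff :: "nat \<Rightarrow> real \<Rightarrow> real \<Rightarrow> nat \<Rightarrow> real" where
  "jacobi_coeff n \<alpha> \<beta> k = real (n choose k) * pochhammer (real n + \<alpha> + \<beta> + 1) k
                      * pochhammer (\<alpha> + real k + 1) (n - k) / fact n"

lemma jacobi_coeff_eq_0: "k > n \<Longrightarrow> jacobi_coeff n \<alpha> \<beta> k = 0"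
  by (simp add: jacobi_coeff_def)

text \<open>The term ratio of the hypergeometric series for P_n. The division-free form tolerates
  \<alpha> + k + 1 = 0 and covers every k: for k = n the factor n - k vanishes, and for k > n both
  coefficients do.\<close>

lemma jacobi_coeff_Suc:
  "(real k + 1) * (\<alpha> + real k + 1) * jacobi_coeff n \<alpha> \<beta> (Suc k) =
   (real n - real k) * (real n + \<alpha> + \<beta> + 1 + real k) * jacobi_coeff n \<alpha> \<beta> k"
proof (cases "k < n")
  case True
  then obtain m where m: "n - k = Suc m" "n - Suc k = m" "real n - real k = real m + 1"
    by (metis Suc_diff_Suc of_nat_Suc of_nat_diff less_imp_le add.commute)
  have 1: "real (n choose Suc k) * (real k + 1) = real (n choose k) * (real n - real k)"
  proof -
    have "Suc k * (n choose Suc k) = (n - k) * (n choose k)"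
      using binomial_absorb_comp[of n k] binomial_absorption[of k n] by simp
    then show ?thesis using True
      by (metis mult.commute of_nat_Suc of_nat_diff of_nat_mult less_imp_le add.commute)
  qed
  have 2: "pochhammer (\<alpha> + real k + 1) (n - k)
         = (\<alpha> + real k + 1) * pochhammer (\<alpha> + real (Suc k) + 1) (n - Suc k)"
    unfolding m by (simp add: pochhammer_rec add_ac)
  have "(real k + 1) * (\<alpha> + real k + 1) * jacobi_coeff n \<alpha> \<beta> (Suc k)
     = (real (n choose Suc k) * (real k + 1)) * pochhammer (real n + \<alpha> + \<beta> + 1) (Suc k)
       * ((\<alpha> + real k + 1) * pochhammer (\<alpha> + real (Suc k) + 1) (n - Suc k)) / fact n"
    by (simp add: jacobi_coeff_def)
  also have "\<dots> = (real n - real k) * (real n + \<alpha> + \<beta> + 1 + real k) * jacobi_coeff n \<alpha> \<beta> k"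
    unfolding 1 2[symmetric] by (simp add: jacobi_coeff_def pochhammer_Suc)
  finally show ?thesis .
next
  case False
  then show ?thesis by (cases "k = n") (auto simp: jacobi_coeff_eq_0)
qed

definition jacobi_shifted :: "nat \<Rightarrow> real \<Rightarrow> real \<Rightarrow> real poly" where
  "jacobi_shifted n \<alpha> \<beta> = (\<Sum>k\<le>n. Polynomial.monom (jacobi_coeff n \<alpha> \<beta> k) k)"

lemma coeff_jacobi_shifted [simp]: "coeff (jacobi_shifted n \<alpha> \<beta>) k = jacobi_coeff n \<alpha> \<beta> k"
  by (auto simp: jacobi_shifted_def coeff_sum jacobi_coeff_eq_0)

lemma jacobi_poly_pcompose: "jacobi_poly n \<alpha> \<beta> = pcompose (jacobi_shifted n \<alpha> \<beta>) [:-1/2, 1/2:]"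
  by (rule poly_ext) (simp add: jacobi_poly_def jacobi_shifted_def poly_pcompose poly_sum poly_monom
      jacobi_coeff_def diff_divide_distrib)

text \<open>Under x = 1 + 2 t the factor 1 - x^2 becomes -4 t (1 + t), which explains the
  coefficients. Comparing powers of t leaves exactly the recurrence
  \<open>jacobi_coeff_Suc\<close>.\<close>

lemma jacobi_shifted_ode:
  "[:0, -1, -1:] * pderiv (pderiv (jacobi_shifted n \<alpha> \<beta>))
   + [:-(\<alpha> + 1), -(\<alpha> + \<beta> + 2):] * pderiv (jacobi_shifted n \<alpha> \<beta>)
   + Polynomial.smult (real n * (real n + \<alpha> + \<beta> + 1)) (jacobi_shifted n \<alpha> \<beta>) = 0"
proof (rule poly_eqI)
  fix k
  let ?c = "jacobi_coeff n \<alpha> \<beta>"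
  have rec: "(real k + 1) * (\<alpha> + real k + 1) * ?c (Suc k) =
   (real n - real k) * (real n + \<alpha> + \<beta> + 1 + real k) * ?c k" by (rule jacobi_coeff_Suc)
  have "coeff ([:0, -1, -1:] * pderiv (pderiv (jacobi_shifted n \<alpha> \<beta>))
   + [:-(\<alpha> + 1), -(\<alpha> + \<beta> + 2):] * pderiv (jacobi_shifted n \<alpha> \<beta>)
   + Polynomial.smult (real n * (real n + \<alpha> + \<beta> + 1)) (jacobi_shifted n \<alpha> \<beta>)) k
   = (real n - real k) * (real n + \<alpha> + \<beta> + 1 + real k) * ?c k
     - (real k + 1) * (\<alpha> + real k + 1) * ?c (Suc k)"
  \<comment> \<open>Multiplication by t and t^2 shifts indices, so k = 0 and k = 1 are separated
    from the generic case.\<close>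
  proof (cases k)
    case 0
    then show ?thesis by (simp add: coeff_pderiv algebra_simps)
  next
    case (Suc m)
    then show ?thesis by (cases m) (simp_all add: coeff_pderiv algebra_simps)
  qed
  then show "coeff ([:0, -1, -1:] * pderiv (pderiv (jacobi_shifted n \<alpha> \<beta>))
   + [:-(\<alpha> + 1), -(\<alpha> + \<beta> + 2):] * pderiv (jacobi_shifted n \<alpha> \<beta>)
   + Polynomial.smult (real n * (real n + \<alpha> + \<beta> + 1)) (jacobi_shifted n \<alpha> \<beta>)) k = coeff 0 k"
    using rec by simp
qed

lemma jacobi_poly_ode:
  "jacobi_q * pderiv (pderiv (jacobi_poly n \<alpha> \<beta>)) + jacobi_r \<alpha> \<beta> * pderiv (jacobi_poly n \<alpha> \<beta>)
   + Polynomial.smult (real n * (real n + \<alpha> + \<beta> + 1)) (jacobi_poly n \<alpha> \<beta>) = 0"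
proof (rule poly_ext)
  fix x :: real
  define Y t where "Y = jacobi_shifted n \<alpha> \<beta>" and "t = (x - 1) / 2"
  have d1: "poly (pderiv (jacobi_poly n \<alpha> \<beta>)) x = poly (pderiv Y) t / 2"
    and d2: "poly (pderiv (pderiv (jacobi_poly n \<alpha> \<beta>))) x = poly (pderiv (pderiv Y)) t / 4"
    and d0: "poly (jacobi_poly n \<alpha> \<beta>) x = poly Y t"
    by (simp_all add: jacobi_poly_pcompose pderiv_pcompose poly_pcompose pderiv_mult pderiv_smult Y_def t_def
          pderiv_pCons diff_divide_distrib)
  have x: "x = 1 + 2 * t" by (simp add: t_def field_simps)
  have "poly ([:0, -1, -1:] * pderiv (pderiv Y) + [:-(\<alpha> + 1), -(\<alpha> + \<beta> + 2):] * pderiv Y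
   + Polynomial.smult (real n * (real n + \<alpha> + \<beta> + 1)) Y) t = 0"
    unfolding Y_def jacobi_shifted_ode by simp
  then show "poly (jacobi_q * pderiv (pderiv (jacobi_poly n \<alpha> \<beta>)) + jacobi_r \<alpha> \<beta> * pderiv (jacobi_poly n \<alpha> \<beta>)
   + Polynomial.smult (real n * (real n + \<alpha> + \<beta> + 1)) (jacobi_poly n \<alpha> \<beta>)) x = poly 0 x"
    unfolding poly_add poly_mult poly_smult d0 d1 d2 unfolding x
    by (simp add: algebra_simps)
qed

text \<open>For n > 0 all factors n + \<alpha> + \<beta> + 1 + i of the leading coefficient are
  positive, because n + \<alpha> + \<beta> + 1 > n - 1.\<close>

lemma degree_jacobi_poly:
  assumes "\<alpha> + \<beta> > -2"
  shows "degree (jacobi_poly n \<alpha> \<beta>) = n"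
proof -
  have "pochhammer (real n + \<alpha> + \<beta> + 1) n \<noteq> 0"
    using assms by (cases "n = 0") (auto simp: pochhammer_eq_0_iff)
  then have "jacobi_coeff n \<alpha> \<beta> n \<noteq> 0"
    by (simp add: jacobi_coeff_def)
  then have "degree (jacobi_shifted n \<alpha> \<beta>) = n"
    by (intro antisym le_degree degree_le) (auto simp: jacobi_coeff_eq_0)
  then show ?thesis by (simp add: jacobi_poly_pcompose degree_pcompose)
qed

lemma jacobi_poly_nonzero:
  assumes "\<alpha> + \<beta> > -2"
  shows "jacobi_poly n \<alpha> \<beta> \<noteq> 0"
proof (cases "n = 0")
  case True
  then show ?thesis by (simp add: jacobi_poly_def)
next
  case False
  then show ?thesis using degree_jacobi_poly[OF assms, of n] by auto
qed

section \<open>The Jacobi measure\<close>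

text \<open>The substitution t = (1 + x) / 2 reduces this to the Beta integral with parameters
  \<beta> + 1 and \<alpha> + 1. The powers of 2 come from 1 + x = 2 t and 1 - x = 2 (1 - t).\<close>

lemma set_integrable_jacobi_weight:
  assumes "\<alpha> > -1" "\<beta> > -1"
  shows "set_integrable lborel {-1..1} (jacobi_weight \<alpha> \<beta>)"
proof -
  let ?f = "\<lambda>t. indicator {0..1} t *\<^sub>R (t powr (\<beta> + 1 - 1) * (1 - t) powr (\<alpha> + 1 - 1)) :: real"
  have "integrable lborel ?f"
    using integrable_Beta[of "\<beta> + 1" "\<alpha> + 1"] assms by (simp add: set_integrable_def)
  then have "integrable lborel (\<lambda>x. ?f (1/2 + 1/2 * x))"
    by (rule lborel_integrable_real_affine) simp
  then have "integrable lborel (\<lambda>x. 2 powr \<alpha> * 2 powr \<beta> * ?f (1/2 + 1/2 * x))"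
    by (rule integrable_mult_right)
  also have "(\<lambda>x. 2 powr \<alpha> * 2 powr \<beta> * ?f (1/2 + 1/2 * x))
      = (\<lambda>x. indicator {-1..1} x *\<^sub>R jacobi_weight \<alpha> \<beta> x)" (is "?g = ?h")
  proof
    fix x :: real
    show "?g x = ?h x"
    proof (cases "x \<in> {-1..1}")
      case True
      then have "(1 - x) powr \<alpha> = 2 powr \<alpha> * (1 - (1/2 + 1/2 * x)) powr \<alpha>"
        "(1 + x) powr \<beta> = 2 powr \<beta> * (1/2 + 1/2 * x) powr \<beta>"
        by (simp_all add: powr_mult[symmetric] algebra_simps)
      with True show ?thesis by (simp add: jacobi_weight_def)
    qed (auto simp: indicator_def)
  qed
  finally show ?thesis by (simp add: set_integrable_def)
qed

lemma borel_measurable_jacobi_weight [measurable]: "jacobi_weight \<alpha> \<beta> \<in> borel_measurable borel"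
  unfolding jacobi_weight_def[abs_def] by measurable

lemma jacobi_weight_pos: "-1 < x \<Longrightarrow> x < 1 \<Longrightarrow> jacobi_weight \<alpha> \<beta> x > 0"
  by (simp add: jacobi_weight_def)

lemma jacobi_weight_nonneg: "jacobi_weight \<alpha> \<beta> x \<ge> 0"
  by (simp add: jacobi_weight_def)

lemma borel_measurable_poly [measurable]: "poly (p :: real poly) \<in> borel_measurable borel"
  by (intro borel_measurable_continuous_onI continuous_intros)

text \<open>A polynomial is bounded on [-1, 1], so a multiple of the weight dominates the
  integrand.\<close>

lemma integrable_jacobi_weight_poly:
  assumes "\<alpha> > -1" "\<beta> > -1"
  shows "integrable lborel (\<lambda>x. indicator {-1<..<1} x * jacobi_weight \<alpha> \<beta> x * poly p x)"
proof -
  have "compact ((\<lambda>x. poly p x) ` {-1..1})"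
    by (intro compact_continuous_image continuous_intros) auto
  then obtain B where B: "\<And>x. x \<in> {-1..1} \<Longrightarrow> \<bar>poly p x\<bar> \<le> B"
    using compact_imp_bounded bounded_iff by (metis imageI real_norm_def)
  have "B \<ge> 0" using order_trans[OF abs_ge_zero B[of 0]] by simp
  have "integrable lborel (\<lambda>x. B * (indicator {-1..1} x *\<^sub>R jacobi_weight \<alpha> \<beta> x))"
    using set_integrable_jacobi_weight[OF assms] by (simp add: set_integrable_def)
  then show ?thesis
  proof (rule Bochner_Integration.integrable_bound)
    show "AE x in lborel. norm (indicator {-1<..<1} x * jacobi_weight \<alpha> \<beta> x * poly p x)
            \<le> norm (B * (indicator {-1..1} x *\<^sub>R jacobi_weight \<alpha> \<beta> x))"
      using B \<open>B \<ge> 0\<close>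
      by (intro AE_I2) (auto simp: indicator_def abs_mult mult.commute[of B] jacobi_weight_nonneg
          intro: mult_left_mono)
  qed measurable
qed

text \<open>If the integral were zero, p would vanish almost everywhere on ]-1, 1[. Its roots being
  finite in number, the interval would be a null set.\<close>

lemma integral_jacobi_weight_square_pos:
  assumes "\<alpha> > -1" "\<beta> > -1" "p \<noteq> 0"
  shows "(LINT x|lborel. indicator {-1<..<1} x * jacobi_weight \<alpha> \<beta> x * (poly p x)\<^sup>2) > 0"
proof -
  let ?f = "\<lambda>x. indicator {-1<..<1} x * jacobi_weight \<alpha> \<beta> x * (poly p x)\<^sup>2"
  have int: "integrable lborel ?f"
    using integrable_jacobi_weight_poly[OF assms(1,2), of "p ^ 2"] by simp
  have nn: "?f x \<ge> 0" for x by (simp add: jacobi_weight_nonneg)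
  have "integral\<^sup>L lborel ?f \<noteq> 0"
  proof
    assume "integral\<^sup>L lborel ?f = 0"
    then have ae: "AE x in lborel. ?f x = 0"
      using integral_nonneg_eq_0_iff_AE[OF int] nn by simp
    let ?Z = "{x. poly p x = 0}"
    have "finite ?Z" using assms(3) by (rule poly_roots_finite)
    then have "AE x in lborel. x \<notin> ?Z"
      by (intro AE_not_in finite_imp_null_set_lborel)
    with ae have "AE x in lborel. x \<notin> {-1<..<1::real}"
    proof eventually_elim
      case (elim x)
      then show ?case using jacobi_weight_pos[of x \<alpha> \<beta>] by (auto simp: indicator_def split: if_splits)
    qed
    then have "{-1<..<1::real} \<in> null_sets lborel"
      by (subst (asm) AE_iff_null_sets[symmetric]) auto
    then show False by (simp add: null_sets_def)
  qed
  moreover have "integral\<^sup>L lborel ?f \<ge> 0" using nn by simp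
  ultimately show ?thesis by simp
qed

definition jacobi_expectation :: "real \<Rightarrow> real \<Rightarrow> real poly \<Rightarrow> real" where
  "jacobi_expectation \<alpha> \<beta> p = (LINT x|jacobi_measure \<alpha> \<beta>. poly p x)"

lemma jacobi_weight_mass_pos:
  assumes "\<alpha> > -1" "\<beta> > -1"
  shows "(LBINT y:{-1<..<1}. jacobi_weight \<alpha> \<beta> y) > 0"
  using integral_jacobi_weight_square_pos[OF assms, of 1] by (simp add: set_lebesgue_integral_def)

lemma jacobi_expectation_eq:
  assumes "\<alpha> > -1" "\<beta> > -1"
  shows "jacobi_expectation \<alpha> \<beta> p =
    (LINT x|lborel. indicator {-1<..<1} x * jacobi_weight \<alpha> \<beta> x * poly p x)
     / (LBINT y:{-1<..<1}. jacobi_weight \<alpha> \<beta> y)"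
proof -
  let ?Z = "LBINT y:{-1<..<1}. jacobi_weight \<alpha> \<beta> y"
  have Z: "?Z > 0" by (rule jacobi_weight_mass_pos[OF assms])
  have "jacobi_measure \<alpha> \<beta>
     = density lborel (\<lambda>x. ennreal (indicator {-1<..<1} x * jacobi_weight \<alpha> \<beta> x / ?Z))"
    by (simp add: jacobi_measure_def)
  then have "jacobi_expectation \<alpha> \<beta> p =
    (LINT x|lborel. (indicator {-1<..<1} x * jacobi_weight \<alpha> \<beta> x / ?Z) *\<^sub>R poly p x)"
    unfolding jacobi_expectation_def using Z
    by (simp only:) (intro integral_density; auto simp: jacobi_weight_nonneg intro!: AE_I2)
  also have "\<dots> = (LINT x|lborel. (indicator {-1<..<1} x * jacobi_weight \<alpha> \<beta> x * poly p x) / ?Z)"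
    by simp
  finally show ?thesis by (simp only: integral_divide_zero)
qed

text \<open>With W the weight, (q W)' = r W on the open interval. Hence the integrand is the
  derivative of \<open>F\<close> = q W f, which is continuous up to the endpoints because \<alpha> +
  1 and \<beta> + 1 are positive.\<close>

lemma integral_jacobi_weight_pearson:
  assumes "\<alpha> > -1" "\<beta> > -1"
  shows "(LINT x|lborel. indicator {-1<..<1} x * jacobi_weight \<alpha> \<beta> x *
     poly (jacobi_q * pderiv f + jacobi_r \<alpha> \<beta> * f) x) = 0"
proof -
  let ?g = "jacobi_q * pderiv f + jacobi_r \<alpha> \<beta> * f"
  define F where "F x = (1 - x) powr (\<alpha> + 1) * (1 + x) powr (\<beta> + 1) * poly f x" for x :: real
  have "((\<lambda>x. jacobi_weight \<alpha> \<beta> x * poly ?g x) has_integral F 1 - F (-1)) {-1..1}"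
  \<comment> \<open>The exponents \<alpha> + 1 and \<beta> + 1 may be below 1, so differentiability
    is asserted in the interior only.\<close>
  proof (rule fundamental_theorem_of_calculus_interior)
    show "continuous_on {-1..1} F"
      unfolding F_def using assms by (intro continuous_intros continuous_on_powr') auto
  next
    fix x :: real assume x: "x \<in> {-1<..<1}"
    have "(F has_real_derivative
        (- ((\<alpha> + 1) * (1 - x) powr \<alpha>)) * ((1 + x) powr (\<beta> + 1) * poly f x)
         + (1 - x) powr (\<alpha> + 1) * ((\<beta> + 1) * (1 + x) powr \<beta> * poly f x
              + (1 + x) powr (\<beta> + 1) * poly (pderiv f) x)) (at x)"
      unfolding F_def using x
      by (auto intro!: derivative_eq_intros simp: algebra_simps)
    moreover have "(1 - x) powr (\<alpha> + 1) = (1 - x) powr \<alpha> * (1 - x)"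
      "(1 + x) powr (\<beta> + 1) = (1 + x) powr \<beta> * (1 + x)"
      using x by (simp_all add: powr_add)
    ultimately have "(F has_real_derivative
        (- ((\<alpha> + 1) * (1 - x) powr \<alpha>)) * (((1 + x) powr \<beta> * (1 + x)) * poly f x)
         + ((1 - x) powr \<alpha> * (1 - x)) * ((\<beta> + 1) * (1 + x) powr \<beta> * poly f x
              + ((1 + x) powr \<beta> * (1 + x)) * poly (pderiv f) x)) (at x)"
      by simp
    then have "(F has_real_derivative jacobi_weight \<alpha> \<beta> x * poly ?g x) (at x)"
      by (rule DERIV_cong) (simp add: jacobi_weight_def algebra_simps)
    then show "(F has_vector_derivative jacobi_weight \<alpha> \<beta> x * poly ?g x) (at x)"
      by (simp add: has_real_derivative_iff_has_vector_derivative)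
  qed simp
  \<comment> \<open>Each boundary value contains a factor of the form \<open>0 powr y\<close>, which
    is 0.\<close>
  moreover have "F 1 = 0" "F (-1) = 0" by (simp_all add: F_def)
  ultimately have "((\<lambda>x. jacobi_weight \<alpha> \<beta> x * poly ?g x) has_integral 0) {-1<..<1}"
    by (simp add: has_integral_Icc_iff_Ioo)
  moreover have si: "set_integrable lborel {-1<..<1} (\<lambda>x. jacobi_weight \<alpha> \<beta> x * poly ?g x)"
    using integrable_jacobi_weight_poly[OF assms, of ?g] by (simp only: set_integrable_def real_scaleR_def mult.assoc)
  ultimately have "(LBINT x:{-1<..<1}. jacobi_weight \<alpha> \<beta> x * poly ?g x) = 0"
    using set_borel_integral_eq_integral(2)[OF si] by (simp only: integral_unique)
  then show ?thesis by (simp only: set_lebesgue_integral_def real_scaleR_def mult.assoc)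
qed

lemma jacobi_expectation_add:
  assumes "\<alpha> > -1" "\<beta> > -1"
  shows "jacobi_expectation \<alpha> \<beta> (f + g) = jacobi_expectation \<alpha> \<beta> f + jacobi_expectation \<alpha> \<beta> g"
  using integrable_jacobi_weight_poly[OF assms]
  by (simp add: jacobi_expectation_eq[OF assms] distrib_left add_divide_distrib)

lemma jacobi_expectation_smult:
  assumes "\<alpha> > -1" "\<beta> > -1"
  shows "jacobi_expectation \<alpha> \<beta> (Polynomial.smult c f) = c * jacobi_expectation \<alpha> \<beta> f"
  by (simp add: jacobi_expectation_def)

lemma jacobi_expectation_square_pos:
  assumes "\<alpha> > -1" "\<beta> > -1" "f \<noteq> 0"
  shows "jacobi_expectation \<alpha> \<beta> (f * f) > 0"
  using integral_jacobi_weight_square_pos[OF assms] jacobi_weight_mass_pos[OF assms(1,2)]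
  by (simp add: jacobi_expectation_eq[OF assms(1,2)] power2_eq_square)

lemma jacobi_expectation_pearson:
  assumes "\<alpha> > -1" "\<beta> > -1"
  shows "jacobi_expectation \<alpha> \<beta> (jacobi_q * pderiv f + jacobi_r \<alpha> \<beta> * f) = 0"
  unfolding jacobi_expectation_eq[OF assms] integral_jacobi_weight_pearson[OF assms] by simp

section \<open>The action of the Hessian on residues\<close>

definition monic_roots :: "'a set \<Rightarrow> ('a \<Rightarrow> real) \<Rightarrow> real poly" where
  "monic_roots I z = (\<Prod>l\<in>I. [:- z l, 1:])"

lemma poly_monic_roots: "poly (monic_roots I z) x = (\<Prod>l\<in>I. x - z l)"
  by (simp add: monic_roots_def poly_prod)

lemma poly_monic_roots_eq_0: "finite I \<Longrightarrow> l \<in> I \<Longrightarrow> poly (monic_roots I z) (z l) = 0"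
  by (auto simp: poly_monic_roots)

lemma degree_monic_roots: "degree (monic_roots I z) = card I"
  by (simp add: monic_roots_def degree_prod_eq_sum_degree)

lemma lead_coeff_monic_roots: "lead_coeff (monic_roots I z) = 1"
  by (simp add: monic_roots_def lead_coeff_prod)

lemma monic_roots_remove:
  "finite I \<Longrightarrow> l \<in> I \<Longrightarrow> monic_roots I z = [:- z l, 1:] * monic_roots (I - {l}) z"
  unfolding monic_roots_def by (rule prod.remove)

lemma pderiv_linear_mult:
  "pderiv ([:- c, 1:] * p) = p + [:- c, 1:] * pderiv p" for c :: real
  by (simp only: pderiv_mult) (simp add: pderiv_pCons)

lemma pderiv_sum: "pderiv (\<Sum>x\<in>A. f x) = (\<Sum>x\<in>A. pderiv (f x))" for f :: "'a \<Rightarrow> real poly"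
  by (induction A rule: infinite_finite_induct) (auto simp: pderiv_add)

text \<open>By Leibniz' rule for p = (x - z_l) h, the m-th derivative of p at z_l is m times the
  (m-1)-st derivative of h there. This is m = 1; the cases m = 2 and m = 3 follow.\<close>

lemma poly_pderiv_monic_roots:
  assumes "finite I" "l \<in> I"
  shows "poly (pderiv (monic_roots I z)) (z l) = poly (monic_roots (I - {l}) z) (z l)"
  unfolding monic_roots_remove[OF assms] by (simp add: pderiv_linear_mult pderiv_add del: mult_pCons_left)

lemma poly_pderiv2_monic_roots:
  assumes "finite I" "l \<in> I"
  shows "poly (pderiv (pderiv (monic_roots I z))) (z l) = 2 * poly (pderiv (monic_roots (I - {l}) z)) (z l)"
  unfolding monic_roots_remove[OF assms] by (simp add: pderiv_linear_mult pderiv_add del: mult_pCons_left)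

lemma poly_pderiv3_monic_roots:
  assumes "finite I" "l \<in> I"
  shows "poly (pderiv (pderiv (pderiv (monic_roots I z)))) (z l)
       = 3 * poly (pderiv (pderiv (monic_roots (I - {l}) z))) (z l)"
proof -
  have "pderiv (2 :: real poly) = 0"
    by (simp add: numeral_poly pderiv_pCons)
  then show ?thesis
    unfolding monic_roots_remove[OF assms]
    by (simp add: pderiv_linear_mult pderiv_add pderiv_mult[of 2] del: mult_pCons_left)
qed

lemma monic_roots_remove_nonzero:
  assumes "finite I" "inj_on z I" "l \<in> I"
  shows "poly (monic_roots (I - {l}) z) (z l) \<noteq> 0"
  using assms by (auto simp: poly_monic_roots inj_on_def)

text \<open>Both sides have degree below the number of nodes and agree at each node: the l-th
  summand vanishes at the other nodes, and p'(z_l) is the value at z_l of its product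
  polynomial.\<close>

lemma lagrange_interpolation:
  assumes "finite I" "inj_on z I" "degree f < card I"
  shows "f = (\<Sum>l\<in>I. Polynomial.smult (poly f (z l) / poly (pderiv (monic_roots I z)) (z l))
                 (monic_roots (I - {l}) z))" (is "_ = ?g")
proof (rule poly_eqI_degree[where A = "z ` I"])
  have card: "card (z ` I) = card I" using assms by (simp add: card_image)
  show "degree f < card (z ` I)" using assms card by simp
  have "degree ?g \<le> card I - 1"
    by (intro degree_sum_le order.trans[OF degree_smult_le]) (auto simp: degree_monic_roots assms(1))
  then show "degree ?g < card (z ` I)" using assms(3) card by simp
  fix x assume "x \<in> z ` I"
  then obtain j where j: "j \<in> I" "x = z j" by auto
  have "poly ?g x = (\<Sum>l\<in>I. if l = j then poly f (z j) else 0)"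
    unfolding poly_sum
    by (rule sum.cong) (use j assms poly_pderiv_monic_roots[OF assms(1)] monic_roots_remove_nonzero[OF assms(1,2)]
         in \<open>auto simp: poly_monic_roots_eq_0\<close>)
  then show "poly f x = poly ?g x" using j assms(1) by simp
qed

text \<open>This is the linear coefficient in the Laurent expansion of $f/p$ at the pole $z_j$.\<close>
lemma sum_residues_over_square:
  fixes z :: "'a \<Rightarrow> real" and I :: "'a set"
  defines "p \<equiv> monic_roots I z"
  assumes fin: "finite I" and inj: "inj_on z I" and deg: "degree f < card I" and j: "j \<in> I"
  defines "h \<equiv> monic_roots (I - {j}) z"
  defines "v \<equiv> \<lambda>l. poly f (z l) / poly (pderiv p) (z l)"
  shows "(\<Sum>l\<in>I - {j}. v l / (z j - z l)\<^sup>2) * poly h (z j) =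
     poly (pderiv h) (z j) / poly h (z j) * (poly (pderiv f) (z j) - v j * poly (pderiv h) (z j))
      - (poly (pderiv (pderiv f)) (z j) - v j * poly (pderiv (pderiv h)) (z j)) / 2"
proof -
  let ?J = "I - {j}"
  let ?h = "\<lambda>l. monic_roots (?J - {l}) z"
  \<comment> \<open>Dividing f = v_j h + (x - z_j) G by p = (x - z_j) h shows that G / h is the
    regular part of f / p at z_j. The wanted sum is minus the derivative of G / h there.\<close>
  define G where "G = (\<Sum>l\<in>?J. Polynomial.smult (v l) (?h l))"
  have hne: "poly h (z j) \<noteq> 0"
    unfolding h_def using monic_roots_remove_nonzero[OF fin inj j] .
  have "f = (\<Sum>l\<in>I. Polynomial.smult (v l) (monic_roots (I - {l}) z))"
    unfolding v_def p_def by (rule lagrange_interpolation[OF fin inj deg])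
  also have "\<dots> = Polynomial.smult (v j) h + (\<Sum>l\<in>?J. Polynomial.smult (v l) (monic_roots (I - {l}) z))"
    unfolding h_def by (rule sum.remove[OF fin j])
  also have "(\<Sum>l\<in>?J. Polynomial.smult (v l) (monic_roots (I - {l}) z)) = [:- z j, 1:] * G"
    unfolding G_def sum_distrib_left
  proof (rule sum.cong)
    fix l assume "l \<in> ?J"
    then have "j \<in> I - {l}" using j by auto
    then have "monic_roots (I - {l}) z = [:- z j, 1:] * ?h l"
      using monic_roots_remove[of "I - {l}" j z] fin by (simp add: insert_commute Diff_insert2[symmetric] Diff_insert[symmetric])
    then show "Polynomial.smult (v l) (monic_roots (I - {l}) z) = [:- z j, 1:] * Polynomial.smult (v l) (?h l)"
      by simp
  qed simp
  finally have f: "f = Polynomial.smult (v j) h + [:- z j, 1:] * G" .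
  have f1: "poly (pderiv f) (z j) = v j * poly (pderiv h) (z j) + poly G (z j)"
    and f2: "poly (pderiv (pderiv f)) (z j) = v j * poly (pderiv (pderiv h)) (z j) + 2 * poly (pderiv G) (z j)"
    by (subst f, simp add: pderiv_linear_mult pderiv_add pderiv_smult del: mult_pCons_left)+
  have "poly (pderiv G) (z j) = (\<Sum>l\<in>?J. v l * poly (pderiv (?h l)) (z j))"
    by (simp add: G_def pderiv_sum poly_sum pderiv_smult)
  \<comment> \<open>Since \<open>?h l\<close> is h / (x - z_l), each summand is an instance of the
    quotient rule.\<close>
  also have "\<dots> = (\<Sum>l\<in>?J. poly (pderiv h) (z j) / poly h (z j) * (v l * poly (?h l) (z j))
                - v l / (z j - z l)\<^sup>2 * poly h (z j))"
  proof (rule sum.cong)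
    fix l assume l: "l \<in> ?J"
    have ne: "z j \<noteq> z l" using l j inj by (auto simp: inj_on_def)
    have h: "h = [:- z l, 1:] * ?h l"
      unfolding h_def using monic_roots_remove[of ?J l z] fin l by simp
    have h0: "poly h (z j) = (z j - z l) * poly (?h l) (z j)"
      and h1: "poly (pderiv h) (z j) = poly (?h l) (z j) + (z j - z l) * poly (pderiv (?h l)) (z j)"
      by (subst h, simp add: pderiv_linear_mult del: mult_pCons_left)+
    have aux: "c * g1 = (g + u * g1) / (u * g) * (c * g) - c / u\<^sup>2 * (u * g)"
      if "u \<noteq> 0" "g \<noteq> 0" for c g g1 u :: real
      using that by (simp add: field_simps power2_eq_square)
    have "poly (?h l) (z j) \<noteq> 0" using h0 hne by auto
    with ne show "v l * poly (pderiv (?h l)) (z j) =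
         poly (pderiv h) (z j) / poly h (z j) * (v l * poly (?h l) (z j)) - v l / (z j - z l)\<^sup>2 * poly h (z j)"
      unfolding h0 h1 by (intro aux) auto
  qed simp
  also have "\<dots> = poly (pderiv h) (z j) / poly h (z j) * poly G (z j) - (\<Sum>l\<in>?J. v l / (z j - z l)\<^sup>2) * poly h (z j)"
    by (simp add: sum_subtractf G_def poly_sum sum_distrib_left sum_distrib_right)
  finally have G1: "poly (pderiv G) (z j) = \<dots>" .
  have "(\<Sum>l\<in>?J. v l / (z j - z l)\<^sup>2) * poly h (z j) =
      poly (pderiv h) (z j) / poly h (z j) * poly G (z j) - poly (pderiv G) (z j)"
    unfolding G1 by simp
  also have "poly G (z j) = poly (pderiv f) (z j) - v j * poly (pderiv h) (z j)"
    using f1 by simp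
  also have "poly (pderiv G) (z j) = (poly (pderiv (pderiv f)) (z j) - v j * poly (pderiv (pderiv h)) (z j)) / 2"
    using f2 by simp
  finally show ?thesis .
qed

text \<open>Pure algebra at a node x: \<open>h\<close>, \<open>h1\<close>, \<open>h2\<close> stand
  for p / (x - z_j) and its derivatives, \<open>f0\<close>, \<open>f1\<close>, \<open>f2\<close> for
  those of f. The assumptions \<open>p2\<close>, \<open>p3\<close> and \<open>f2\<close> are the
  differential equation of p, its derivative, and the equation of f. \<open>T1\<close> is the
  residue sum for f = p', where every v_l equals 1.\<close>

lemma jacobi_hessian_algebra:
  fixes x \<alpha> \<beta> :: real
  assumes q: "1 - x\<^sup>2 \<noteq> 0" and h: "h \<noteq> 0"
    and p2: "(1 - x\<^sup>2) * (2 * h1) + (\<beta> - \<alpha> - (\<alpha> + \<beta> + 2) * x) * h = 0"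
    and p3: "(1 - x\<^sup>2) * (3 * h2) + (\<beta> - \<alpha> - (\<alpha> + \<beta> + 4) * x) * (2 * h1) + (\<Lambda> - (\<alpha> + \<beta> + 2)) * h = 0"
    and f2: "(1 - x\<^sup>2) * f2 + (\<beta> - \<alpha> - (\<alpha> + \<beta> + 2) * x) * f1 + \<mu> * f0 = 0"
    and T: "T * h = h1 / h * (f1 - f0 / h * h1) - (f2 - f0 / h * h2) / 2"
    and T1: "T1 * h = h1 / h * (2 * h1 - h1) - (3 * h2 - h2) / 2"
  shows "(T1 + (\<alpha> + 1) / 2 * (1 / (1 - x)\<^sup>2) + (\<beta> + 1) / 2 * (1 / (1 + x)\<^sup>2)) * (f0 / h) - T
       = (\<Lambda> - \<mu>) / 2 * (f0 / h) / (1 - x\<^sup>2)"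
proof -
  define q r where "q = 1 - x\<^sup>2" and "r = \<beta> - \<alpha> - (\<alpha> + \<beta> + 2) * x"
  define W where "W = (\<alpha> + 1) / 2 * (1 / (1 - x)\<^sup>2) + (\<beta> + 1) / 2 * (1 / (1 + x)\<^sup>2)"
  have q0: "q \<noteq> 0" using assms(1) by (simp add: q_def)
  have x: "1 - x \<noteq> 0" "1 + x \<noteq> 0" using q0 unfolding q_def by (auto simp: power2_eq_square add_eq_0_iff)
  have qf: "q = (1 - x) * (1 + x)" by (simp add: q_def power2_eq_square algebra_simps)
  have W: "2 * q\<^sup>2 * W = (\<alpha> + 1) * (1 + x)\<^sup>2 + (\<beta> + 1) * (1 - x)\<^sup>2"
  proof -
    have "2 * (u * v)\<^sup>2 * ((\<alpha> + 1) / 2 * (1 / u\<^sup>2) + (\<beta> + 1) / 2 * (1 / v\<^sup>2))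
        = (\<alpha> + 1) * v\<^sup>2 + (\<beta> + 1) * u\<^sup>2" if "u \<noteq> 0" "v \<noteq> 0" for u v :: real
      using that by (simp add: field_simps power2_eq_square)
    from this[OF x] show ?thesis by (simp add: W_def qf)
  qed
  have h1: "h1 = - r * h / (2 * q)"
    using p2 q0 unfolding q_def[symmetric] r_def[symmetric] by (simp add: field_simps)
  have h2: "h2 = ((r - 2 * x) * r / q - (\<Lambda> - (\<alpha> + \<beta> + 2))) * h / (3 * q)"
  proof -
    have eq: "\<beta> - \<alpha> - (\<alpha> + \<beta> + 4) * x = r - 2 * x" by (simp add: r_def algebra_simps)
    have "3 * q * h2 = - (r - 2 * x) * (2 * h1) - (\<Lambda> - (\<alpha> + \<beta> + 2)) * h"
      using p3 unfolding q_def[symmetric] eq by (simp add: algebra_simps)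
    also have "\<dots> = ((r - 2 * x) * r / q - (\<Lambda> - (\<alpha> + \<beta> + 2))) * h"
      unfolding h1 using q0 by (simp add: field_simps)
    finally show ?thesis using q0 by (simp add: field_simps)
  qed
  have f2': "f2 = - (r * f1 + \<mu> * f0) / q"
    using f2 q0 unfolding q_def[symmetric] r_def[symmetric] by (simp add: field_simps)
  \<comment> \<open>\<open>A\<close> and \<open>B\<close> are the logarithmic ratios h'/h and h''/h
    at the node, expressed through q, r and \<Lambda> alone.\<close>
  define B where "B = ((r - 2 * x) * r / q - (\<Lambda> - (\<alpha> + \<beta> + 2))) / (3 * q)"
  define A where "A = - r / (2 * q)"
  have h1': "h1 = A * h" and h2': "h2 = B * h" by (simp_all add: h1 h2 A_def B_def)
  define v where "v = f0 / h"
  have f0: "f0 = v * h" using h by (simp add: v_def)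
  have "T1 * h = (A\<^sup>2 - B) * h"
    unfolding T1 unfolding h1' h2' using h by (simp add: algebra_simps power2_eq_square)
  then have T1': "T1 = A\<^sup>2 - B" using h by simp
  \<comment> \<open>Since A = -r / (2 q), the differential equation of f cancels \<open>f1\<close>.
    Only a multiple of f0 survives, which is why the result is proportional to v_j.\<close>
  have f12: "A * f1 - f2 / 2 = v * (\<mu> / (2 * q)) * h"
    unfolding f2' A_def f0 using q0 by (simp add: field_simps)
  have "T * h = A * f1 - f2 / 2 + v * (B / 2 - A\<^sup>2) * h"
    unfolding T v_def[symmetric] unfolding h1' h2' using h
    by (simp add: algebra_simps power2_eq_square diff_divide_distrib add_divide_distrib)
  also have "\<dots> = v * (\<mu> / (2 * q) - A\<^sup>2 + B / 2) * h"
    unfolding f12 by (simp only: algebra_simps)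
  finally have T': "T = v * (\<mu> / (2 * q) - A\<^sup>2 + B / 2)"
    using h by simp
  \<comment> \<open>Everything independent of f is collected here. The endpoint terms of the
    diagonal of S_N have just the weights that turn the sum into \<Lambda> / (2 q).\<close>
  have AB: "2 * A\<^sup>2 - B * (3 / 2) + W = \<Lambda> / (2 * q)"
  proof -
    have A2: "4 * q\<^sup>2 * A\<^sup>2 = r\<^sup>2"
      unfolding A_def using q0 by (simp add: power2_eq_square)
    have B3: "3 * q\<^sup>2 * B = (r - 2 * x) * r - (\<Lambda> - (\<alpha> + \<beta> + 2)) * q"
      unfolding B_def using q0 by (simp add: field_simps power2_eq_square)
    have "2 * q\<^sup>2 * (2 * A\<^sup>2 - B * (3 / 2) + W) = 4 * q\<^sup>2 * A\<^sup>2 - 3 * q\<^sup>2 * B + 2 * q\<^sup>2 * W"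
      by (simp add: algebra_simps)
    also have "\<dots> = \<Lambda> * q"
      unfolding A2 B3 W by (simp add: q_def r_def algebra_simps power2_eq_square)
    also have "\<dots> = 2 * q\<^sup>2 * (\<Lambda> / (2 * q))"
      using q0 by (simp add: power2_eq_square)
    finally show ?thesis
      by (subst (asm) mult_left_cancel) (use q0 in auto)
  qed
  have "(T1 + W) * v - T = v * (2 * A\<^sup>2 - B * (3 / 2) + W - \<mu> / (2 * q))"
    unfolding T1' T' by (simp add: algebra_simps)
  also have "\<dots> = (\<Lambda> - \<mu>) / 2 * v / q"
    unfolding AB using q0 by (simp add: field_simps)
  finally show ?thesis unfolding W_def q_def v_def by (simp only: add.assoc)
qed

text \<open>The off-diagonal part of row i is the residue sum of f, and the sum in the diagonal
  entry is the same expression for p'. Both differential equations then reduce the row to a multiple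
  of v_i.\<close>

lemma S_mat_residues:
  fixes \<alpha> \<beta> :: real
  assumes inj: "inj_on z {..<N}" and i: "i < N" and q: "1 - (z i)\<^sup>2 \<noteq> 0"
    and ab: "a + b = \<alpha> + 1" "b = \<beta> + 1"
  defines "p \<equiv> monic_roots {..<N} z"
  assumes p_ode: "jacobi_q * pderiv (pderiv p) + jacobi_r \<alpha> \<beta> * pderiv p + Polynomial.smult \<Lambda> p = 0"
    and f_ode: "jacobi_q * pderiv (pderiv f) + jacobi_r \<alpha> \<beta> * pderiv f + Polynomial.smult \<mu> f = 0"
    and deg: "degree f < N"
  shows "(\<Sum>l<N. S_mat N a b z $$ (i, l) * (poly f (z l) / poly (pderiv p) (z l)))
     = (\<Lambda> - \<mu>) / 2 * (poly f (z i) / poly (pderiv p) (z i)) / (1 - (z i)\<^sup>2)"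
proof -
  let ?I = "{..<N}" and ?v = "\<lambda>l. poly f (z l) / poly (pderiv p) (z l)"
  define h where "h = monic_roots (?I - {i}) z"
  define T where "T = (\<Sum>l\<in>?I - {i}. ?v l / (z i - z l)\<^sup>2)"
  define T1 where "T1 = (\<Sum>l\<in>?I - {i}. 1 / (z i - z l)\<^sup>2)"
  define W where "W = (a + b) / 2 * (1 / (1 - z i)\<^sup>2) + b / 2 * (1 / (1 + z i)\<^sup>2)"
  have iI: "i \<in> ?I" using i by simp
  have p1: "poly (pderiv p) (z l) = poly (monic_roots (?I - {l}) z) (z l)" if "l \<in> ?I" for l
    using that unfolding p_def by (intro poly_pderiv_monic_roots) auto
  have p1i: "poly (pderiv p) (z i) = poly h (z i)" using p1[OF iI] by (simp add: h_def)
  have p2: "poly (pderiv (pderiv p)) (z i) = 2 * poly (pderiv h) (z i)"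
    unfolding p_def h_def using iI by (intro poly_pderiv2_monic_roots) auto
  have p3: "poly (pderiv (pderiv (pderiv p))) (z i) = 3 * poly (pderiv (pderiv h)) (z i)"
    unfolding p_def h_def using iI by (intro poly_pderiv3_monic_roots) auto
  have p0: "poly p (z i) = 0" unfolding p_def using iI by (intro poly_monic_roots_eq_0) auto
  have h: "poly h (z i) \<noteq> 0" unfolding h_def using inj iI by (intro monic_roots_remove_nonzero) auto
  have dp: "degree (pderiv p) < N" using i by (simp add: degree_pderiv p_def degree_monic_roots)
  \<comment> \<open>All residues of p'/p equal 1, so \<open>sum_residues_over_square\<close> with f
    = p' evaluates \<open>T1\<close>.\<close>
  have "(\<Sum>l\<in>?I - {i}. poly (pderiv p) (z l) / poly (pderiv p) (z l) / (z i - z l)\<^sup>2) = T1"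
    unfolding T1_def
    by (rule sum.cong) (use inj monic_roots_remove_nonzero[of ?I z] p1 in auto)
  then have T1: "T1 * poly h (z i) = poly (pderiv h) (z i) / poly h (z i) * (2 * poly (pderiv h) (z i) - poly (pderiv h) (z i))
      - (3 * poly (pderiv (pderiv h)) (z i) - poly (pderiv (pderiv h)) (z i)) / 2"
    using sum_residues_over_square[of ?I z "pderiv p" i] inj iI dp h
    unfolding p_def[symmetric] h_def[symmetric] p3 p2 p1i by simp
  have T: "T * poly h (z i) = poly (pderiv h) (z i) / poly h (z i) *
      (poly (pderiv f) (z i) - poly f (z i) / poly h (z i) * poly (pderiv h) (z i))
      - (poly (pderiv (pderiv f)) (z i) - poly f (z i) / poly h (z i) * poly (pderiv (pderiv h)) (z i)) / 2"
    using sum_residues_over_square[of ?I z f i] inj iI deg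
    unfolding p_def[symmetric] h_def[symmetric] p1i T_def by simp
  have o2: "(1 - (z i)\<^sup>2) * (2 * poly (pderiv h) (z i))
       + (\<beta> - \<alpha> - (\<alpha> + \<beta> + 2) * z i) * poly h (z i) = 0"
    using arg_cong[OF p_ode, of "\<lambda>g. poly g (z i)"]
    by (simp add: p0 p1i p2 power2_eq_square algebra_simps)
  \<comment> \<open>The third derivative of p at z_i is obtained by differentiating its equation
    once.\<close>
  have "pderiv (jacobi_q * pderiv (pderiv p) + jacobi_r \<alpha> \<beta> * pderiv p + Polynomial.smult \<Lambda> p) = 0"
    unfolding p_ode by simp
  then have "poly (pderiv jacobi_q * pderiv (pderiv p) + jacobi_q * pderiv (pderiv (pderiv p))
      + (pderiv (jacobi_r \<alpha> \<beta>) * pderiv p + jacobi_r \<alpha> \<beta> * pderiv (pderiv p)) + Polynomial.smult \<Lambda> (pderiv p)) (z i) = 0"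
    by (simp only: pderiv_add pderiv_mult pderiv_smult poly_add poly_mult poly_0 ac_simps)
  then have o3: "(1 - (z i)\<^sup>2) * (3 * poly (pderiv (pderiv h)) (z i))
       + (\<beta> - \<alpha> - (\<alpha> + \<beta> + 4) * z i) * (2 * poly (pderiv h) (z i)) + (\<Lambda> - (\<alpha> + \<beta> + 2)) * poly h (z i) = 0"
    by (simp add: p1i p2 p3 pderiv_pCons power2_eq_square algebra_simps)
  have f_eq: "(1 - (z i)\<^sup>2) * poly (pderiv (pderiv f)) (z i)
       + (\<beta> - \<alpha> - (\<alpha> + \<beta> + 2) * z i) * poly (pderiv f) (z i) + \<mu> * poly f (z i) = 0"
    using arg_cong[OF f_ode, of "\<lambda>g. poly g (z i)"]
    by (simp add: power2_eq_square algebra_simps)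
  have "(\<Sum>l<N. S_mat N a b z $$ (i, l) * ?v l) = S_mat N a b z $$ (i, i) * ?v i
      + (\<Sum>l\<in>?I - {i}. S_mat N a b z $$ (i, l) * ?v l)"
    by (rule sum.remove) (use iI in auto)
  also have "S_mat N a b z $$ (i, i) = T1 + W"
    using i by (simp add: S_mat_def T1_def W_def)
  also have "(\<Sum>l\<in>?I - {i}. S_mat N a b z $$ (i, l) * ?v l) = - T"
    unfolding T_def sum_negf[symmetric] by (rule sum.cong) (use i in \<open>auto simp: S_mat_def\<close>)
  finally have "(\<Sum>l<N. S_mat N a b z $$ (i, l) * ?v l) = (T1 + W) * ?v i - T" by simp
  then show ?thesis
    using jacobi_hessian_algebra[OF q h o2 o3 f_eq T T1]
    unfolding W_def p1i ab(1) unfolding ab(2) by (simp only: add.assoc)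
qed

section \<open>Gauss quadrature at the zeros\<close>

text \<open>The top coefficient is -x^2 times the leading term of g'. The bound on the degree is not
  strict, so g may have a zero coefficient at n.\<close>

lemma jacobi_q_pderiv_bounds:
  assumes "degree g \<le> n"
  shows "degree (jacobi_q * pderiv g) \<le> Suc n" and "coeff (jacobi_q * pderiv g) (Suc n) = - real n * coeff g n"
proof -
  have "degree (jacobi_q * pderiv g) \<le> Suc n \<and> coeff (jacobi_q * pderiv g) (Suc n) = - real n * coeff g n"
  proof (cases n)
    case 0
    then have "pderiv g = 0" using assms by (simp add: pderiv_eq_0_iff)
    then show ?thesis by (simp add: 0)
  next
    case (Suc k)
    have "degree (pderiv g) \<le> k" using assms Suc by (simp add: degree_pderiv)
    moreover have "degree jacobi_q = 2" by simp
    ultimately have "degree (jacobi_q * pderiv g) \<le> Suc n"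
      using degree_mult_le[of jacobi_q "pderiv g"] Suc by linarith
    moreover have "coeff (jacobi_q * f) (Suc (Suc k)) = coeff f (Suc (Suc k)) - coeff f k" for f
      by simp
    then have "coeff (jacobi_q * pderiv g) (Suc n) = - real n * coeff g n"
      using assms unfolding Suc by (simp only: coeff_pderiv) (simp add: coeff_eq_0 algebra_simps)
    ultimately show ?thesis by blast
  qed
  then show "degree (jacobi_q * pderiv g) \<le> Suc n" and "coeff (jacobi_q * pderiv g) (Suc n) = - real n * coeff g n"
    by blast+
qed

lemma linear_mult_bounds:
  assumes "degree g \<le> n"
  shows "degree ([:c0, c1:] * g) \<le> Suc n" and "coeff ([:c0, c1:] * g) (Suc n) = c1 * coeff g n"
proof -
  have "degree [:c0, c1:] \<le> 1" by simp
  then show "degree ([:c0, c1:] * g) \<le> Suc n"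
    using assms degree_mult_le[of "[:c0, c1:]" g] by linarith
  show "coeff ([:c0, c1:] * g) (Suc n) = c1 * coeff g n"
    using assms by (simp add: coeff_eq_0)
qed

section \<open>Orthogonality for an abstract positive functional satisfying the Pearson
  equation\<close>

locale jacobi_functional =
  fixes \<alpha> \<beta> :: real and L :: "real poly \<Rightarrow> real"
  assumes alpha: "\<alpha> > -1" and beta: "\<beta> > -1"
    and L_add: "L (f + g) = L f + L g"
    and L_smult: "L (Polynomial.smult c f) = c * L f"
    and L_square_pos: "f \<noteq> 0 \<Longrightarrow> L (f * f) > 0"
    and L_pearson: "L (jacobi_q * pderiv f + jacobi_r \<alpha> \<beta> * f) = 0"
begin

abbreviation P :: "nat \<Rightarrow> real poly" where
  "P n \<equiv> jacobi_poly n \<alpha> \<beta>"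

abbreviation eig :: "nat \<Rightarrow> real" where
  "eig n \<equiv> real n * (real n + \<alpha> + \<beta> + 1)"

lemma L_zero: "L 0 = 0"
  using L_smult[of 0 0] by simp

lemma L_sum: "L (\<Sum>x\<in>A. f x) = (\<Sum>x\<in>A. L (f x))"
  by (induction A rule: infinite_finite_induct) (auto simp: L_zero L_add)

text \<open>The Pearson equation for f' g is integration by parts. The right-hand side is symmetric
  in f and g, so the Jacobi operator is symmetric for L.\<close>

lemma green:
  "L (g * (jacobi_q * pderiv (pderiv f) + jacobi_r \<alpha> \<beta> * pderiv f)) = - L (jacobi_q * (pderiv f * pderiv g))"
proof -
  have "jacobi_q * pderiv (pderiv f * g) + jacobi_r \<alpha> \<beta> * (pderiv f * g)
    = g * (jacobi_q * pderiv (pderiv f) + jacobi_r \<alpha> \<beta> * pderiv f) + jacobi_q * (pderiv f * pderiv g)"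
    by (simp only: pderiv_mult ring_distribs ac_simps)
  with L_pearson[of "pderiv f * g"] show ?thesis by (simp only: L_add)
qed

lemma degree_P [simp]: "degree (P n) = n"
  using alpha beta by (intro degree_jacobi_poly) simp

lemma P_nonzero [simp]: "P n \<noteq> 0"
  using alpha beta by (intro jacobi_poly_nonzero) simp

lemma eig_diff: "eig n - eig k = (real n - real k) * (real n + real k + \<alpha> + \<beta> + 1)"
  by (simp add: algebra_simps)

text \<open>Eigenvectors of a symmetric operator with different eigenvalues: for k \<noteq> l one
  has k + l + \<alpha> + \<beta> + 1 > 0, so \<open>eig\<close> separates them.\<close>

lemma orthogonal:
  assumes "k \<noteq> l"
  shows "L (P k * P l) = 0"
proof -
  have ode: "jacobi_q * pderiv (pderiv (P n)) + jacobi_r \<alpha> \<beta> * pderiv (P n) = Polynomial.smult (- eig n) (P n)" for n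
    using jacobi_poly_ode[of n \<alpha> \<beta>] by (simp only: eq_neg_iff_add_eq_0 smult_minus_left)
  define ek el X Y where "ek = eig k" and "el = eig l" and "X = L (P l * P k)"
    and "Y = L (jacobi_q * (pderiv (P k) * pderiv (P l)))"
  have "- ek * X = - Y"
    using green[of "P l" "P k"] unfolding ode ek_def X_def Y_def by (simp only: mult_smult_right L_smult)
  moreover have "- el * X = - Y"
    using green[of "P k" "P l"]
    unfolding ode el_def X_def Y_def mult.commute[of "P l"] mult.commute[of "pderiv (P k)"]
    by (simp only: mult_smult_right L_smult)
  ultimately have "(ek - el) * X = 0" by (simp add: left_diff_distrib)
  moreover have "ek - el \<noteq> 0"
    unfolding ek_def el_def eig_diff using assms alpha beta by auto
  ultimately show ?thesis by (simp add: X_def mult.commute)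
qed

lemma orthogonal_lower_degree:
  assumes "degree f < n"
  shows "L (P n * f) = 0"
  using assms
proof (induction "degree f" arbitrary: f rule: less_induct)
  case less
  define m where "m = degree f"
  define c where "c = lead_coeff f / lead_coeff (P m)"
  define g where "g = f - Polynomial.smult c (P m)"
  have "L (P n * P m) = 0" using less.prems by (intro orthogonal) (auto simp: m_def)
  moreover have "L (P n * g) = 0"
  \<comment> \<open>For m = 0 the degree cannot drop further, but then g is a constant with zero
    coefficient.\<close>
  proof (cases "m = 0 \<or> g = 0")
    case True
    have "coeff g m = 0" using leading_coeff_neq_0[OF P_nonzero[of m]] by (simp add: g_def c_def m_def)
    moreover have "degree g \<le> m" unfolding g_def m_def
      by (intro degree_diff_le order.trans[OF degree_smult_le]) auto
    ultimately have "g = 0" using True by (metis le_zero_eq leading_coeff_0_iff)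
    then show ?thesis by (simp add: L_zero)
  next
    case False
    have "degree g \<le> m" unfolding g_def m_def
      by (intro degree_diff_le order.trans[OF degree_smult_le]) auto
    moreover have "coeff g m = 0" using leading_coeff_neq_0[OF P_nonzero[of m]] by (simp add: g_def c_def m_def)
    ultimately have "degree g < m" using False by (metis le_neq_implies_less leading_coeff_0_iff)
    then show ?thesis using less by (auto simp: m_def)
  qed
  moreover have "P n * f = P n * g + Polynomial.smult c (P n * P m)"
    by (simp add: g_def algebra_simps)
  ultimately show ?case by (simp add: L_add L_smult)
qed

end

section \<open>Nodes and weights of the quadrature rule\<close>

locale jacobi_zeros = jacobi_functional +
  fixes N :: nat and z :: "nat \<Rightarrow> real"
  assumes inj: "inj_on z {..<N}" and roots: "\<And>i. i < N \<Longrightarrow> poly (P N) (z i) = 0"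
begin

abbreviation p :: "real poly" where "p \<equiv> monic_roots {..<N} z"

abbreviation d :: "nat \<Rightarrow> real" where "d i \<equiv> poly (pderiv p) (z i)"

abbreviation p_without :: "nat \<Rightarrow> real poly" where
  "p_without i \<equiv> monic_roots ({..<N} - {i}) z"

text \<open>The Christoffel number: L applied to the Lagrange basis polynomial of the node
  z_i.\<close>

definition w :: "nat \<Rightarrow> real" where "w i = L (p_without i) / d i"

lemma P_eq_smult_p: "P N = Polynomial.smult (lead_coeff (P N)) p"
proof (rule poly_eqI_degree_lead_coeff[where A = "z ` {..<N}" and n = N])
  show "coeff (P N) N = coeff (Polynomial.smult (lead_coeff (P N)) p) N"
    using lead_coeff_monic_roots[of "{..<N}" z] by (simp add: degree_monic_roots)
qed (use inj roots in \<open>auto simp: card_image degree_monic_roots poly_monic_roots_eq_0\<close>)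

lemma p_ode: "jacobi_q * pderiv (pderiv p) + jacobi_r \<alpha> \<beta> * pderiv p + Polynomial.smult (eig N) p = 0"
proof -
  define c where "c = lead_coeff (P N)"
  have c: "c \<noteq> 0" using leading_coeff_neq_0[OF P_nonzero[of N]] by (simp add: c_def)
  have P: "P N = Polynomial.smult c p" using P_eq_smult_p by (simp only: c_def)
  have "Polynomial.smult c (jacobi_q * pderiv (pderiv p) + jacobi_r \<alpha> \<beta> * pderiv p + Polynomial.smult (eig N) p)
     = jacobi_q * pderiv (pderiv (P N)) + jacobi_r \<alpha> \<beta> * pderiv (P N) + Polynomial.smult (eig N) (P N)"
    unfolding P by (simp only: pderiv_smult mult_smult_right smult_add_right smult_smult mult.commute[of c])
  also have "\<dots> = 0" by (rule jacobi_poly_ode)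
  finally show ?thesis using c unfolding smult_eq_0_iff by blast
qed

lemma p_orthogonal_lower_degree:
  assumes "degree f < N"
  shows "L (p * f) = 0"
proof -
  have "lead_coeff (P N) * L (p * f) = L (P N * f)"
    by (subst (2) P_eq_smult_p) (simp add: L_smult)
  then show ?thesis
    using orthogonal_lower_degree[OF assms] leading_coeff_neq_0[OF P_nonzero[of N]] by simp
qed

lemma L_p_mult:
  assumes "degree f \<le> N"
  shows "L (p * f) = coeff f N * L (p * p)"
proof -
  define g where "g = f - Polynomial.smult (coeff f N) p"
  have p: "degree p = N" "coeff p N = 1"
    using lead_coeff_monic_roots[of "{..<N}" z] by (auto simp: degree_monic_roots)
  have "L (p * g) = 0"
  proof (cases "g = 0")
    case False
    have "degree g \<le> N" unfolding g_def using assms p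
      by (intro degree_diff_le order.trans[OF degree_smult_le]) auto
    moreover have "coeff g N = 0" using p by (simp add: g_def)
    ultimately have "degree g < N" using False by (metis le_neq_implies_less leading_coeff_0_iff)
    then show ?thesis by (rule p_orthogonal_lower_degree)
  qed (simp add: L_zero)
  moreover have "p * f = p * g + Polynomial.smult (coeff f N) (p * p)"
    by (simp add: g_def algebra_simps)
  ultimately show ?thesis by (simp add: L_add L_smult)
qed

lemma d_eq: "i < N \<Longrightarrow> d i = poly (p_without i) (z i)"
  by (intro poly_pderiv_monic_roots) auto

lemma d_nonzero: "i < N \<Longrightarrow> d i \<noteq> 0"
  unfolding d_eq using inj by (intro monic_roots_remove_nonzero) auto

text \<open>Division of f by x - z_i: the quotient times \<open>p_without i\<close> picks up the
  factor that completes p.\<close>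

lemma L_p_without_mult:
  assumes "i < N"
  shows "L (p_without i * f) = poly f (z i) * L (p_without i) + L (p * synthetic_div f (z i))"
proof -
  have p: "p = [:- z i, 1:] * p_without i"
    using assms by (intro monic_roots_remove) auto
  have "p_without i * f = p_without i * ([:- z i, 1:] * synthetic_div f (z i) + [:poly f (z i):])"
    unfolding synthetic_div_correct' ..
  also have "\<dots> = p * synthetic_div f (z i) + Polynomial.smult (poly f (z i)) (p_without i)"
    unfolding p by (simp only: distrib_left ac_simps) (simp add: algebra_simps)
  finally show ?thesis by (simp only: L_add L_smult)
qed

lemma L_p_without_mult_low:
  assumes "i < N" "degree f \<le> N"
  shows "L (p_without i * f) = poly f (z i) * L (p_without i)"
proof -
  have "degree (synthetic_div f (z i)) < N" using assms by (simp add: degree_synthetic_div)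
  then show ?thesis using L_p_without_mult[OF assms(1)] by (simp add: p_orthogonal_lower_degree)
qed

text \<open>Taking f = \<open>p_without i\<close> in the previous lemma gives d_i L(p_i) = L(p_i^2)
  > 0, where p_i is \<open>p_without i\<close>. Thus L(p_i) and d_i have the same sign.\<close>

lemma w_pos:
  assumes "i < N"
  shows "w i > 0"
proof -
  have "p_without i \<noteq> 0" using d_nonzero[OF assms] d_eq[OF assms] by auto
  then have "L (p_without i * p_without i) > 0" by (rule L_square_pos)
  also have "L (p_without i * p_without i) = d i * L (p_without i)"
    using assms by (subst L_p_without_mult_low) (auto simp: degree_monic_roots d_eq)
  finally show ?thesis unfolding w_def by (auto simp: zero_less_mult_iff zero_less_divide_iff)
qed

text \<open>Expand f in the Lagrange basis and let g be absorbed by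
  \<open>L_p_without_mult_low\<close>. The unequal degree bounds give the Gauss exactness degree 2 N
  - 1 for products.\<close>

lemma quadrature:
  assumes "degree f < N" "degree g \<le> N"
  shows "L (f * g) = (\<Sum>i<N. w i * (poly f (z i) * poly g (z i)))"
proof -
  have "f = (\<Sum>i<N. Polynomial.smult (poly f (z i) / d i) (p_without i))"
    using lagrange_interpolation[of "{..<N}" z f] inj assms by simp
  then have "f * g = (\<Sum>i<N. Polynomial.smult (poly f (z i) / d i) (p_without i)) * g"
    by (rule arg_cong)
  also have "\<dots> = (\<Sum>i<N. Polynomial.smult (poly f (z i) / d i) (p_without i * g))"
    by (simp only: sum_distrib_right mult_smult_left)
  finally have "L (f * g) = (\<Sum>i<N. poly f (z i) / d i * L (p_without i * g))"
    by (simp only: L_sum L_smult)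
  also have "\<dots> = (\<Sum>i<N. w i * (poly f (z i) * poly g (z i)))"
    using assms by (intro sum.cong) (auto simp: L_p_without_mult_low w_def)
  finally show ?thesis .
qed

text \<open>The Pearson equation is applied to p times \<open>p_without i\<close>. Orthogonality of
  p to lower degrees reduces all terms to leading coefficients, apart from the value at z_i, which
  produces the weight.\<close>

lemma weight_formula:
  assumes i: "i < N"
  shows "(1 - (z i)\<^sup>2) * (d i)\<^sup>2 * w i = (2 * real N + \<alpha> + \<beta> + 1) * L (p * p)"
proof -
  obtain m where m: "N = Suc m" using i by (cases N) auto
  have p: "degree p \<le> N" "coeff p N = 1"
    using lead_coeff_monic_roots[of "{..<N}" z] by (simp_all add: degree_monic_roots)
  have card: "card ({..<N} - {i}) = m" using i m by simp
  then have pi: "degree (p_without i) \<le> m" "coeff (p_without i) m = 1"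
    using lead_coeff_monic_roots[of "{..<N} - {i}" z] by (simp_all only: degree_monic_roots order.refl)
  define Q where "Q = jacobi_q * pderiv p"
  have Q: "degree Q \<le> Suc N" "coeff Q (Suc N) = - real N"
    unfolding Q_def using jacobi_q_pderiv_bounds[OF p(1)] p(2) by simp_all
  \<comment> \<open>\<open>Q\<close> may have degree N + 1, one too many for
    \<open>L_p_without_mult_low\<close>, so the quotient \<open>G\<close> contributes a correction
    through its coefficient at N.\<close>
  define G where "G = synthetic_div Q (z i)"
  have degG: "degree G \<le> N" using Q by (simp add: G_def degree_synthetic_div)
  have "Q = [:- z i, 1:] * G + [:poly Q (z i):]"
    unfolding G_def synthetic_div_correct' ..
  then have "coeff Q (Suc N) = coeff ([:- z i, 1:] * G) (Suc N)"
    by (metis (no_types) coeff_add coeff_pCons_Suc coeff_0 add.right_neutral)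
  then have "coeff G N = - real N"
    using linear_mult_bounds(2)[OF degG] Q by simp
  then have G: "L (p * G) = - real N * L (p * p)"
    using L_p_mult[OF degG] by simp
  define H where "H = jacobi_q * pderiv (p_without i) + jacobi_r \<alpha> \<beta> * p_without i"
  have degH: "degree H \<le> N"
    unfolding H_def
    using jacobi_q_pderiv_bounds(1)[OF pi(1)] linear_mult_bounds(1)[OF pi(1)] m
    by (intro degree_add_le) simp_all
  \<comment> \<open>The derivative term contributes -m and the linear factor -(\<alpha> + \<beta> +
    2), with m = N - 1.\<close>
  have "coeff H (Suc m) = - (real m + \<alpha> + \<beta> + 2)"
    unfolding H_def coeff_add jacobi_q_pderiv_bounds(2)[OF pi(1)] linear_mult_bounds(2)[OF pi(1)] pi(2) by simp
  then have "coeff H N = - (real N + \<alpha> + \<beta> + 1)" by (simp add: m)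
  then have H: "L (p * H) = - (real N + \<alpha> + \<beta> + 1) * L (p * p)"
    using L_p_mult[OF degH] by simp
  have "jacobi_q * pderiv (p * p_without i) + jacobi_r \<alpha> \<beta> * (p * p_without i)
      = p_without i * Q + p * H"
    unfolding H_def Q_def by (simp only: pderiv_mult ring_distribs ac_simps)
  with L_pearson[of "p * p_without i"]
  have "L (p_without i * Q) + L (p * H) = 0"
    by (simp only: L_add)
  moreover have "L (p_without i * Q) = poly Q (z i) * L (p_without i) + L (p * G)"
    unfolding G_def by (rule L_p_without_mult[OF i])
  moreover have "poly Q (z i) = (1 - (z i)\<^sup>2) * d i"
    by (simp add: Q_def power2_eq_square algebra_simps)
  moreover have "L (p_without i) = d i * w i" using d_nonzero[OF i] by (simp add: w_def)
  ultimately have "(1 - (z i)\<^sup>2) * d i * (d i * w i) = (real N + \<alpha> + \<beta> + 1) * L (p * p) + real N * L (p * p)"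
    unfolding G H by (simp add: algebra_simps)
  then show ?thesis by (simp add: algebra_simps power2_eq_square)
qed

text \<open>All other factors in \<open>weight_formula\<close> are positive, which fixes the sign of
  1 - z_i^2.\<close>

lemma zeros_in_interval:
  assumes "i < N"
  shows "1 - (z i)\<^sup>2 > 0"
proof -
  have "L (p * p) > 0" using lead_coeff_monic_roots[of "{..<N}" z] by (intro L_square_pos) auto
  moreover have "2 * real N + \<alpha> + \<beta> + 1 > 0" using assms alpha beta by simp
  ultimately have "(1 - (z i)\<^sup>2) * ((d i)\<^sup>2 * w i) > 0"
    using weight_formula[OF assms] by (simp add: mult.assoc)
  moreover have "(d i)\<^sup>2 * w i > 0" using w_pos[OF assms] d_nonzero[OF assms] by simp
  ultimately show ?thesis by (simp add: zero_less_mult_iff)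
qed

definition orthonormal :: "nat \<Rightarrow> real poly" where
  "orthonormal k = Polynomial.smult (1 / sqrt (L (P k * P k))) (P k)"

lemma orthonormal: "L (orthonormal k * orthonormal l) = (if k = l then 1 else 0)"
  using L_square_pos[OF P_nonzero[of k]] by (auto simp: orthonormal_def L_smult orthogonal)

text \<open>By the quadrature rule, the square matrix with entries $\sqrt{w_i} \tilde P_k(z_i)$ has orthonormal
  rows, hence orthonormal columns.\<close>
lemma dual_orthogonality:
  assumes "i < N" "j < N"
  shows "(\<Sum>k<N. poly (orthonormal k) (z i) * poly (orthonormal k) (z j)) = (if i = j then 1 / w i else 0)"
proof -
  define U where "U = Matrix.mat N N (\<lambda>(k, i). sqrt (w i) * poly (orthonormal k) (z i))"
  have U [simp]: "U \<in> carrier_mat N N" "dim_row U = N" "dim_col U = N" by (auto simp: U_def)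
  have "U * transpose_mat U = 1\<^sub>m N"
  proof (rule eq_matI)
    fix k l assume "k < dim_row (1\<^sub>m N :: real mat)" "l < dim_col (1\<^sub>m N :: real mat)"
    then have kl: "k < N" "l < N" by simp_all
    have "(U * transpose_mat U) $$ (k, l) = (\<Sum>i<N. (sqrt (w i) * poly (orthonormal k) (z i)) * (sqrt (w i) * poly (orthonormal l) (z i)))"
      using kl by (simp add: times_mat_def scalar_prod_def atLeast0LessThan) (simp add: U_def)
    also have "\<dots> = (\<Sum>i<N. w i * (poly (orthonormal k) (z i) * poly (orthonormal l) (z i)))"
      using w_pos by (intro sum.cong) (auto simp: real_sqrt_mult_self less_imp_le algebra_simps
          power2_eq_square[symmetric])
    also have "\<dots> = L (orthonormal k * orthonormal l)"
      using kl by (intro quadrature[symmetric]) (auto simp: orthonormal_def)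
    finally show "(U * transpose_mat U) $$ (k, l) = 1\<^sub>m N $$ (k, l)"
      using kl by (simp add: orthonormal)
  qed auto
  then have "transpose_mat U * U = 1\<^sub>m N"
    by (intro mat_mult_left_right_inverse[of U N]) auto
  then have "(transpose_mat U * U) $$ (i, j) = (if i = j then 1 else 0)"
    using assms by simp
  moreover have "(transpose_mat U * U) $$ (i, j) = (\<Sum>k<N. (sqrt (w i) * poly (orthonormal k) (z i)) * (sqrt (w j) * poly (orthonormal k) (z j)))"
    using assms by (simp add: times_mat_def scalar_prod_def atLeast0LessThan) (simp add: U_def)
  ultimately have "sqrt (w i) * sqrt (w j) * (\<Sum>k<N. poly (orthonormal k) (z i) * poly (orthonormal k) (z j)) = (if i = j then 1 else 0)"
    by (simp add: sum_distrib_left algebra_simps)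
  moreover have "sqrt (w i) * sqrt (w i) = w i" using w_pos[OF assms(1)] by simp
  ultimately show ?thesis
    using w_pos[OF assms(1)] w_pos[OF assms(2)]
    by (cases "i = j") (simp_all add: eq_divide_eq mult.commute)
qed

end

section \<open>The inverse of the Hessian\<close>

text \<open>The negative factors z_i - z_l are those with l > i, and there are N - 1 - i of them.
  Multiplying by (-1)^i makes the sign independent of i, so it squares away in products of two such
  values.\<close>

lemma poly_pderiv_monic_roots_sign:
  assumes "strict_mono_on {..<N} z" "i < N"
  shows "(-1) ^ i * poly (pderiv (monic_roots {..<N} z)) (z i)
       = (-1) ^ (N - 1) * \<bar>poly (pderiv (monic_roots {..<N} z)) (z i)\<bar>"
proof -
  let ?J = "{..<N} - {i}"
  have d: "poly (pderiv (monic_roots {..<N} z)) (z i) = (\<Prod>l\<in>?J. z i - z l)"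
    using assms(2) by (subst poly_pderiv_monic_roots) (auto simp: poly_monic_roots)
  have "(\<Prod>l\<in>?J. z i - z l) = (\<Prod>l\<in>?J. (if l < i then 1 else -1) * \<bar>z i - z l\<bar>)"
  proof (rule prod.cong)
    fix l assume "l \<in> ?J"
    then have l: "l < N" "l \<noteq> i" by auto
    then consider "l < i" "z l < z i" | "i < l" "z i < z l"
      using assms by (metis lessThan_iff linorder_neqE_nat strict_mono_onD)
    then show "z i - z l = (if l < i then 1 else -1) * \<bar>z i - z l\<bar>"
      by cases auto
  qed simp
  also have "\<dots> = (\<Prod>l\<in>?J. if l < i then 1 else -1) * \<bar>\<Prod>l\<in>?J. z i - z l\<bar>"
    by (simp add: prod.distrib abs_prod)
  also have "(\<Prod>l\<in>?J. if l < i then 1 else - 1 :: real) = (-1) ^ card (?J \<inter> - {l. l < i})"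
    by (simp add: prod.If_cases)
  also have "?J \<inter> - {l. l < i} = {Suc i..<N}" by auto
  finally have "(\<Prod>l\<in>?J. z i - z l) = (-1) ^ (N - Suc i) * \<bar>\<Prod>l\<in>?J. z i - z l\<bar>" by simp
  moreover have "(-1) ^ i * (-1) ^ (N - Suc i) = ((-1) ^ (N - 1) :: real)"
    using assms(2) by (simp flip: power_add)
  ultimately show ?thesis unfolding d by (metis mult.assoc)
qed

text \<open>A right inverse of a square matrix is two-sided, so \<open>mat_inverse\<close> cannot
  return \<open>None\<close>; its answer C satisfies C = C (A B) = B.\<close>

lemma mat_inverse_eqI:
  fixes A B :: "'a :: field mat"
  assumes "A \<in> carrier_mat n n" "B \<in> carrier_mat n n" "A * B = 1\<^sub>m n"
  shows "mat_inverse A = Some B"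
proof -
  have BA: "B * A = 1\<^sub>m n" by (rule mat_mult_left_right_inverse[OF assms])
  then have "A \<in> Units (ring_mat TYPE('a) n ())"
    using assms unfolding Units_def ring_mat_simps by auto
  then obtain C where C: "mat_inverse A = Some C"
    using mat_inverse(1)[OF assms(1), where b = "()"] by (cases "mat_inverse A") auto
  have inv: "C * A = 1\<^sub>m n" "C \<in> carrier_mat n n"
    using mat_inverse(2)[OF assms(1) C] by auto
  have "C = C * (A * B)" using inv assms by simp
  also have "\<dots> = C * A * B" using inv(2) assms by (intro assoc_mult_mat[symmetric])
  also have "\<dots> = B" using inv assms by simp
  finally show ?thesis using C by simp
qed

lemma jacobi_functional_expectation:
  assumes "\<alpha> > -1" "\<beta> > -1"
  shows "jacobi_functional \<alpha> \<beta> (jacobi_expectation \<alpha> \<beta>)"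
  by (intro jacobi_functional.intro assms jacobi_expectation_add[OF assms] jacobi_expectation_smult[OF assms]
      jacobi_expectation_square_pos[OF assms] jacobi_expectation_pearson[OF assms])

theorem theorem4p12:
  fixes N :: nat and a b \<alpha> \<beta> :: real and z :: "nat \<Rightarrow> real"
  assumes "N \<ge> 2" and "a \<ge> 0" and "b > 0"
    and "\<alpha> = a + b - 1" and "\<beta> = b - 1"
    and "strict_mono_on {..<N} z"
    and "z ` {..<N} = {x. poly (jacobi_poly N \<alpha> \<beta>) x = 0}"
  shows "\<exists>\<Sigma>. mat_inverse (S_mat N a b z) = Some \<Sigma> \<and>
    (\<forall>i<N. \<forall>j<N. \<Sigma> $$ (i, j) =
      (-1) ^ (i + j) * 4 * sqrt (1 - (z i)\<^sup>2) * sqrt (1 - (z j)\<^sup>2)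
      / sqrt (\<Sum>k<N. \<Sum>l<N. (poly (jacobi_orthonormal k \<alpha> \<beta>) (z i)
                             * poly (jacobi_orthonormal l \<alpha> \<beta>) (z j))\<^sup>2)
      * (\<Sum>k<N. poly (jacobi_orthonormal k \<alpha> \<beta>) (z i) * poly (jacobi_orthonormal k \<alpha> \<beta>) (z j)
               / jacobi_lambda N \<alpha> \<beta> (N - k)))"
proof -
  have ab: "\<alpha> > -1" "\<beta> > -1" using assms by auto
  interpret jacobi_functional \<alpha> \<beta> "jacobi_expectation \<alpha> \<beta>"
    by (rule jacobi_functional_expectation[OF ab])
  interpret jacobi_zeros \<alpha> \<beta> "jacobi_expectation \<alpha> \<beta>" N z
  proof
    show "inj_on z {..<N}" using assms(6) by (rule strict_mono_on_imp_inj_on)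
    show "poly (P N) (z i) = 0" if "i < N" for i using assms(7) that by blast
  qed
  have ortho: "jacobi_orthonormal k \<alpha> \<beta> = orthonormal k" for k
  proof -
    have "poly (P k * P k) = (\<lambda>x. (poly (P k) x)\<^sup>2)" by (simp add: fun_eq_iff power2_eq_square)
    then show ?thesis unfolding jacobi_orthonormal_def orthonormal_def jacobi_expectation_def by simp
  qed
  let ?p = "\<lambda>k i. poly (orthonormal k) (z i)"
  let ?lam = "\<lambda>k. jacobi_lambda N \<alpha> \<beta> (N - k)"
  let ?L2 = "jacobi_expectation \<alpha> \<beta> (p * p)"
  define C where "C = (2 * real N + \<alpha> + \<beta> + 1) * ?L2"
  have weight: "(1 - (z i)\<^sup>2) * (d i)\<^sup>2 * w i = C" if "i < N" for i
    using weight_formula[OF that] by (simp only: C_def)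
  \<comment> \<open>The index N - k is explained by eig N - eig k = (N - k) (N + k + \<alpha> +
    \<beta> + 1), which is half of \<lambda>_(N-k).\<close>
  have lambda: "(eig N - eig k) / 2 = ?lam k / 4" and lambda_pos: "?lam k > 0" if "k < N" for k
  proof -
    have eq: "?lam k = 2 * (real N - real k) * (real N + real k + \<alpha> + \<beta> + 1)"
      using that by (simp add: jacobi_lambda_def of_nat_diff)
    show "(eig N - eig k) / 2 = ?lam k / 4" unfolding eq eig_diff by simp
    show "?lam k > 0" unfolding eq using that ab by simp
  qed
  define M where "M = Matrix.mat N N (\<lambda>(i, j). 4 * C / (d i * d j) * (\<Sum>k<N. ?p k i * ?p k j / ?lam k))"
  have S: "S_mat N a b z \<in> carrier_mat N N" and M: "M \<in> carrier_mat N N"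
    by (simp_all add: S_mat_def M_def)
  have "S_mat N a b z * M = 1\<^sub>m N"
  proof (rule eq_matI)
    fix i j assume "i < dim_row (1\<^sub>m N :: real mat)" "j < dim_col (1\<^sub>m N :: real mat)"
    then have ij: "i < N" "j < N" by simp_all
    have q: "1 - (z i)\<^sup>2 > 0" by (rule zeros_in_interval[OF ij(1)])
    have row: "(\<Sum>l<N. S_mat N a b z $$ (i, l) * (?p k l / d l)) = ?lam k / 4 * (?p k i / d i) / (1 - (z i)\<^sup>2)"
      if k: "k < N" for k
      unfolding lambda[OF k, symmetric]
    proof (rule S_mat_residues)
      show "jacobi_q * pderiv (pderiv (orthonormal k)) + jacobi_r \<alpha> \<beta> * pderiv (orthonormal k)
          + Polynomial.smult (eig k) (orthonormal k) = 0" (is "?E = 0")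
      proof -
        define c where "c = 1 / sqrt (jacobi_expectation \<alpha> \<beta> (P k * P k))"
        have "orthonormal k = Polynomial.smult c (P k)" by (simp only: orthonormal_def c_def)
        then have "?E = Polynomial.smult c (jacobi_q * pderiv (pderiv (P k)) + jacobi_r \<alpha> \<beta> * pderiv (P k)
            + Polynomial.smult (eig k) (P k))"
          by (simp only: pderiv_smult mult_smult_right smult_add_right smult_smult mult.commute[of c])
        then show ?thesis unfolding jacobi_poly_ode by simp
      qed
      show "degree (orthonormal k) < N" using k by (simp add: orthonormal_def)
    qed (use inj ij q assms p_ode in auto)
    have "(S_mat N a b z * M) $$ (i, j) = (\<Sum>l<N. S_mat N a b z $$ (i, l) * M $$ (l, j))"
      using ij S M by (simp add: times_mat_def scalar_prod_def atLeast0LessThan)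
    \<comment> \<open>Column j of \<open>M\<close> is a combination over k of the vectors with
      entries \<open>?p k l / d l\<close>, on which \<open>row\<close> gives the action of
      S_N.\<close>
    also have "\<dots> = (\<Sum>l<N. \<Sum>k<N. 4 * C / d j * ?p k j / ?lam k * (S_mat N a b z $$ (i, l) * (?p k l / d l)))"
      using ij by (intro sum.cong) (auto simp: M_def sum_distrib_left mult_ac intro!: sum.cong)
    also have "\<dots> = (\<Sum>k<N. 4 * C / d j * ?p k j / ?lam k * (\<Sum>l<N. S_mat N a b z $$ (i, l) * (?p k l / d l)))"
      by (subst sum.swap) (simp only: sum_distrib_left)
    \<comment> \<open>The factor \<lambda>_(N-k) / 4 from \<open>row\<close> cancels the one in
      \<open>M\<close>, leaving the kernel of \<open>dual_orthogonality\<close>.\<close>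
    also have "\<dots> = (\<Sum>k<N. C / (d i * d j * (1 - (z i)\<^sup>2)) * (?p k i * ?p k j))"
    proof (rule sum.cong)
      fix k assume "k \<in> {..<N}"
      then have k: "k < N" by simp
      show "4 * C / d j * ?p k j / ?lam k * (\<Sum>l<N. S_mat N a b z $$ (i, l) * (?p k l / d l))
          = C / (d i * d j * (1 - (z i)\<^sup>2)) * (?p k i * ?p k j)"
        unfolding row[OF k] using lambda_pos[OF k] by (simp add: mult_ac)
    qed simp
    also have "\<dots> = C / (d i * d j * (1 - (z i)\<^sup>2)) * (if i = j then 1 / w i else 0)"
      by (simp only: sum_distrib_left[symmetric] dual_orthogonality[OF ij])
    also have "\<dots> = (if i = j then 1 else 0)"
      using weight[OF ij(1), symmetric] d_nonzero[OF ij(1)] w_pos[OF ij(1)] q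
      by (auto simp: power2_eq_square)
    finally show "(S_mat N a b z * M) $$ (i, j) = 1\<^sub>m N $$ (i, j)" using ij by simp
  qed (use S M in auto)
  then have "mat_inverse (S_mat N a b z) = Some M"
    by (rule mat_inverse_eqI[OF S M])
  moreover have "M $$ (i, j) = (-1) ^ (i + j) * 4 * sqrt (1 - (z i)\<^sup>2) * sqrt (1 - (z j)\<^sup>2)
      / sqrt (\<Sum>k<N. \<Sum>l<N. (?p k i * ?p l j)\<^sup>2) * (\<Sum>k<N. ?p k i * ?p k j / ?lam k)"
    if ij: "i < N" "j < N" for i j
  proof -
    define s where "s i = sqrt (1 - (z i)\<^sup>2)" for i
    have s: "s i > 0" "(s i)\<^sup>2 = 1 - (z i)\<^sup>2" if "i < N" for i
      using zeros_in_interval[OF that] by (auto simp: s_def)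
    have Cpos: "C > 0"
      using weight[OF ij(1), symmetric] d_nonzero[OF ij(1)] w_pos[OF ij(1)] zeros_in_interval[OF ij(1)]
      by simp
    have K: "(\<Sum>k<N. (?p k i)\<^sup>2) = (s i * d i)\<^sup>2 / C" if "i < N" for i
    proof -
      have "(\<Sum>k<N. (?p k i)\<^sup>2) = 1 / w i"
        using dual_orthogonality[OF that that] by (simp add: power2_eq_square)
      also have "\<dots> = (s i * d i)\<^sup>2 / C"
        using weight[OF that] w_pos[OF that] Cpos by (simp add: power_mult_distrib s(2)[OF that] field_simps)
      finally show ?thesis .
    qed
    \<comment> \<open>The double sum factors into two diagonal kernel values, each a square over C,
      so the root is an absolute value.\<close>
    have "(\<Sum>k<N. \<Sum>l<N. (?p k i * ?p l j)\<^sup>2) = (\<Sum>k<N. (?p k i)\<^sup>2) * (\<Sum>l<N. (?p l j)\<^sup>2)"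
      by (simp only: power_mult_distrib sum_product)
    also have "\<dots> = (s i * d i * (s j * d j) / C)\<^sup>2"
      unfolding K[OF ij(1)] K[OF ij(2)] by (simp add: power2_eq_square)
    finally have "sqrt (\<Sum>k<N. \<Sum>l<N. (?p k i * ?p l j)\<^sup>2) = \<bar>s i * d i * (s j * d j) / C\<bar>"
      by simp
    \<comment> \<open>The sign lemma resolves this absolute value. Counting indices from 0 shifts i
      + j by 2 and leaves (-1)^(i+j) unchanged.\<close>
    also have "\<dots> = s i * s j * ((-1) ^ (i + j) * (d i * d j)) / C"
    proof -
      have "(-1) ^ (i + j) * (d i * d j) = ((-1) ^ i * d i) * ((-1) ^ j * d j)"
        by (simp add: power_add)
      also have "\<dots> = ((-1) ^ (N - 1) * (-1) ^ (N - 1)) * (\<bar>d i\<bar> * \<bar>d j\<bar>)"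
        unfolding poly_pderiv_monic_roots_sign[OF assms(6) ij(1)] poly_pderiv_monic_roots_sign[OF assms(6) ij(2)]
        by simp
      also have "(-1) ^ (N - 1) * (-1) ^ (N - 1) = (1 :: real)"
        by (simp flip: power_mult_distrib)
      finally show ?thesis using s(1)[OF ij(1)] s(1)[OF ij(2)] Cpos by (simp add: abs_mult)
    qed
    finally have den: "sqrt (\<Sum>k<N. \<Sum>l<N. (?p k i * ?p l j)\<^sup>2) = s i * s j * ((-1) ^ (i + j) * (d i * d j)) / C" .
    have "(-1) ^ (i + j) * 4 * s i * s j / (s i * s j * ((-1) ^ (i + j) * (d i * d j)) / C) = 4 * C / (d i * d j)"
      using s(1)[OF ij(1)] s(1)[OF ij(2)] by simp
    then show ?thesis
      unfolding den s_def[symmetric] using ij by (simp only: M_def index_mat case_prod_conv)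
  qed
  ultimately show ?thesis unfolding ortho by blast
qed

end
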